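(* Assume that $U_0$ is monotonically non-decreasing, i.e. $\frac{\mathrm{d}}{\mathrm{d}x}U_0(x)\ge0$ for $x\in\mathbb{R}_+$. Then the solution $(U(x,t),Q(x,t))$ of the one-dimensional problem described in the context satisfies $$\frac{\partial}{\partial x}U(x,t)\ge0,\qquad Q(x,t)\le0,\qquad (x,t)\in\mathbb{R}_+\times\mathbb{R}_+.$$
   Context: $\mathbb{R}_+=(0,\infty)$. $f:\mathbb{R}\to\mathbb{R}$ is smooth with $f''(u)\ge\alpha>0$ for all $u$, and $f(0)=f'(0)=0$; $u_\pm$ are constants with $0\le f'(u_-)<f'(u_+)$. The problem for $(U,Q)$ is $$U_t+f(U)_x+Q_x=0,\qquad -Q_{xx}+Q+U_x=0,\qquad x\in\mathbb{R}_+,\ t>0,$$ with initial data $U(x,0)=U_0(x)$ and boundary conditions $$U(0,t)=u_-,\quad Q_x(0,t)=0,\quad U(+\infty,t)=u_+,\quad Q(+\infty,t)=0.$$ *)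

theory Defs
  imports "HOL-Analysis.Analysis"
begin

definition smooth :: "(real \<Rightarrow> real) \<Rightarrow> bool" where
  "smooth f \<longleftrightarrow> (\<forall>n x. (deriv ^^ n) f differentiable (at x))"

text \<open>Functions of space and time are curried, space first: \<open>U x t\<close>.\<close>

definition dx :: "(real \<Rightarrow> real \<Rightarrow> real) \<Rightarrow> real \<Rightarrow> real \<Rightarrow> real" where
  "dx W x t = deriv (\<lambda>y. W y t) x"

definition dt :: "(real \<Rightarrow> real \<Rightarrow> real) \<Rightarrow> real \<Rightarrow> real \<Rightarrow> real" where
  "dt W x t = deriv (\<lambda>s. W x s) t"

text \<open>Classical derivatives: \<open>deriv\<close> is an arbitrary value where no derivative exists, so
  existence is required separately.\<close>

definition C1_quadrant :: "(real \<Rightarrow> real \<Rightarrow> real) \<Rightarrow> bool" where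
  "C1_quadrant W \<longleftrightarrow>
     (\<forall>x>0. \<forall>t>0. (\<lambda>y. W y t) differentiable (at x) \<and> (\<lambda>s. W x s) differentiable (at t)) \<and>
     continuous_on ({0<..} \<times> {0<..}) (\<lambda>(x, t). dx W x t) \<and>
     continuous_on ({0<..} \<times> {0<..}) (\<lambda>(x, t). dt W x t)"

text \<open>Global classical solutions of the initial-boundary value problem on the half line.
  \<open>U\<close> is \<open>C\<^sup>1\<close> in the open quadrant, continuous up to its boundary, and bounded on every
  strip \<open>0 < t < T\<close>; no bound on the derivatives of \<open>U\<close> is imposed.
  Continuity of \<open>dx Q\<close> and of \<open>dx (dx Q)\<close> in \<open>x\<close> follows from the two equations.
  The Neumann condition at \<open>x = 0\<close> is a one-sided derivative.\<close>

definition radiating_gas_solution ::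
    "(real \<Rightarrow> real) \<Rightarrow> real \<Rightarrow> real \<Rightarrow> (real \<Rightarrow> real) \<Rightarrow>
     (real \<Rightarrow> real \<Rightarrow> real) \<Rightarrow> (real \<Rightarrow> real \<Rightarrow> real) \<Rightarrow> bool" where
  "radiating_gas_solution f um up U0 U Q \<longleftrightarrow>
     C1_quadrant U \<and>
     continuous_on ({0..} \<times> {0..}) (\<lambda>(x, t). U x t) \<and>
     (\<forall>T>0. bounded ((\<lambda>(x, t). U x t) ` ({0<..} \<times> {0<..<T}))) \<and>
     (\<forall>x>0. \<forall>t>0. (\<lambda>y. Q y t) differentiable (at x) \<and> (\<lambda>y. dx Q y t) differentiable (at x)) \<and>
     (\<forall>x>0. \<forall>t>0. dt U x t + dx (\<lambda>y s. f (U y s)) x t + dx Q x t = 0) \<and>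
     (\<forall>x>0. \<forall>t>0. - dx (dx Q) x t + Q x t + dx U x t = 0) \<and>
     (\<forall>x>0. U x 0 = U0 x) \<and>
     (\<forall>t>0. U 0 t = um) \<and>
     (\<forall>t>0. ((\<lambda>x. Q x t) has_real_derivative 0) (at 0 within {0..})) \<and>
     (\<forall>t>0. ((\<lambda>x. U x t) \<longlongrightarrow> up) at_top) \<and>
     (\<forall>t>0. ((\<lambda>x. Q x t) \<longlongrightarrow> 0) at_top)"

end

theory Submission
  imports Defs
begin

text \<open>
  The function \<open>w = U - dx Q\<close> turns the system into a relaxation equation driven by a
  screened potential: the elliptic equation gives \<open>dx w = - Q\<close> and hence
  \<open>w - dx (dx w) = U\<close>, the Neumann condition becomes the Dirichlet condition
  \<open>w 0 t = um\<close>, and the first equation reads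
  \<open>dt U + f' (U) * dx U = w - U\<close>. Both claims say that a function is non-decreasing in
  space, namely \<open>U\<close> and \<open>w\<close>.

  The proof is a maximum principle for functions of \<^emph>\<open>two\<close> points. Suppose that on
  \<open>0 < t \<le> T\<close> the solution falls by at most \<open>N\<close> between any two points
  \<open>x \<le> y\<close>. Then so does \<open>w\<close>: where \<open>w y - w x\<close> is minimal, the second
  derivatives have the right signs (\<open>screened_potential_drop_bound\<close>). Consider next a
  minimum of \<open>U y t - U x t\<close> over pairs of points. Both space derivatives vanish there, so
  the transport term disappears, whatever the size of \<open>dx U\<close> elsewhere, and what remains is
  \<open>dt (U y t - U x t) = (w y t - w x t) - (U y t - U x t)\<close>. Relaxation towards something
  that is at least \<open>- N\<close>, starting from a non-negative value, gives the better bound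
  \<open>N * (1 - exp (- t))\<close> for the fall (\<open>relaxation_drop_bound\<close>). If \<open>N\<close> is the
  largest fall on the strip, this reads \<open>N \<le> N * (1 - exp (- T))\<close>, so \<open>N = 0\<close>.

  At the boundary point \<open>x = 0\<close> the functions \<open>U\<close> and \<open>w\<close> share the constant
  value \<open>um\<close>, so the relaxation balance \<open>dt U = w - U\<close> holds there as well,
  and pairs with \<open>x = 0\<close> are treated like interior ones. Minima are made to exist
  on the unbounded domain by a small penalty proportional to the larger point \<open>y\<close>.
\<close>

section \<open>Minima and derivatives\<close>

lemma negative_minimum_attained:
  fixes F :: "'a::topological_space \<Rightarrow> real"
  assumes "compact K" "K \<subseteq> S" "continuous_on S F"
    and out: "\<And>q. q \<in> S - K \<Longrightarrow> 0 \<le> F q"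
    and a: "a \<in> S" "F a < 0"
  obtains p where "p \<in> S" "F p < 0" "\<And>q. q \<in> S \<Longrightarrow> F p \<le> F q"
proof -
  have aK: "a \<in> K"
    using out[of a] a by force
  then obtain p where p: "p \<in> K" "\<And>q. q \<in> K \<Longrightarrow> F p \<le> F q"
    using continuous_attains_inf[OF assms(1)] continuous_on_subset[OF assms(3,2)]
    by (metis empty_iff)
  have "F p < 0"
    using p(2)[OF aK] a(2) by linarith
  show ?thesis
  proof
    show "p \<in> S" using p(1) assms(2) by blast
    show "F p < 0" by fact
    show "F p \<le> F q" if "q \<in> S" for q
      using p(2)[of q] out[of q] that \<open>F p < 0\<close> by (cases "q \<in> K") auto
  qed
qed

lemma second_derivative_nonneg_at_min:
  fixes v v' :: "real \<Rightarrow> real"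
  assumes "0 < r"
    and v: "\<And>x. \<bar>x - a\<bar> < r \<Longrightarrow> (v has_real_derivative v' x) (at x)"
    and v': "(v' has_real_derivative d) (at a)"
    and min: "\<And>x. \<bar>x - a\<bar> < r \<Longrightarrow> v a \<le> v x"
  shows "0 \<le> d"
proof (rule ccontr)
  assume "\<not> 0 \<le> d"
  then obtain e where e: "0 < e" "\<And>h. 0 < h \<Longrightarrow> h < e \<Longrightarrow> v' (a + h) < v' a"
    using DERIV_neg_dec_right[OF v'] by auto
  have v'a: "v' a = 0"
    by (rule DERIV_local_min[OF v \<open>0 < r\<close>]) (use min \<open>0 < r\<close> in \<open>auto simp: abs_minus_commute\<close>)
  define h where "h = min e r / 2"
  have h: "0 < h" "h < e" "h < r"
    using e(1) \<open>0 < r\<close> by (auto simp: h_def)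
  obtain z where z: "a < z" "z < a + h" "v (a + h) - v a = (a + h - a) * v' z"
    using MVT2[of a "a + h" v v'] h v by auto
  have "v' z < 0"
    using e(2)[of "z - a"] z h v'a by auto
  then have "h * v' z < 0"
    using h by (simp add: mult_pos_neg)
  then have "v (a + h) < v a"
    using z(3) by simp
  then show False
    using min[of "a + h"] h by auto
qed

lemma derivative_nonneg_of_right_min:
  fixes g :: "real \<Rightarrow> real"
  assumes g': "(g has_real_derivative d) (at x)" and g: "\<And>y. x \<le> y \<Longrightarrow> g x \<le> g y"
  shows "0 \<le> d"
proof (rule ccontr)
  assume "\<not> 0 \<le> d"
  then obtain e where e: "0 < e" "\<And>h. 0 < h \<Longrightarrow> h < e \<Longrightarrow> g (x + h) < g x"
    using DERIV_neg_dec_right[OF g'] by auto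
  have "g (x + e / 2) < g x"
    by (rule e(2)) (use e(1) in auto)
  then show False using g[of "x + e / 2"] e(1) by simp
qed

section \<open>The screened potential\<close>

text \<open>The only candidate is \<open>w = u - q'\<close>, but \<open>q'\<close> is known for positive \<open>x\<close>
  only. Since \<open>(u - q')' = - q\<close> and \<open>q\<close> is continuous up to \<open>0\<close>, an
  antiderivative of \<open>- q\<close> extends \<open>u - q'\<close> continuously to \<open>0\<close>. So \<open>q'\<close> has
  a limit at \<open>0\<close>, which must agree with the one-sided derivative of \<open>q\<close> there; this is
  how the Neumann condition for \<open>q\<close> becomes the Dirichlet condition \<open>w 0 = u 0\<close>.\<close>

lemma screened_potential_exists:
  fixes u u' q q' :: "real \<Rightarrow> real"
  assumes u: "continuous_on {0..} u"
    and u': "\<And>x. 0 < x \<Longrightarrow> (u has_real_derivative u' x) (at x)"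
    and q': "\<And>x. 0 < x \<Longrightarrow> (q has_real_derivative q' x) (at x)"
    and q'': "\<And>x. 0 < x \<Longrightarrow> (q' has_real_derivative q x + u' x) (at x)"
    and q0: "(q has_real_derivative 0) (at 0 within {0..})"
  obtains w where "continuous_on {0..} w" "w 0 = u 0"
    "\<And>x. 0 < x \<Longrightarrow> (w has_real_derivative - q x) (at x)"
    "\<And>x. 0 < x \<Longrightarrow> q' x = u x - w x"
proof -
  have q_cont: "continuous_on {0..} q"
    unfolding continuous_on_eq_continuous_within
  proof
    fix x :: real assume "x \<in> {0..}"
    then consider "x = 0" | "0 < x" by force
    then show "continuous (at x within {0..}) q"
      by cases (use q0 q' DERIV_isCont DERIV_continuous continuous_at_imp_continuous_at_within in blast)+
  qed
  define W where "W x = - integral {0..x} q" for x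
  have W_within: "(W has_real_derivative - q x) (at x within {0..b})" if "0 \<le> x" "x \<le> b" for x b
    unfolding W_def
    by (intro derivative_intros integral_has_real_derivative continuous_on_subset[OF q_cont])
      (use that in auto)
  have W': "(W has_real_derivative - q x) (at x)" if "0 < x" for x
  proof -
    have "at x within {0..x + 1} = at x"
      by (rule at_within_interior) (use that in auto)
    then show ?thesis using W_within[of x "x + 1"] that by simp
  qed
  have W_cont: "continuous_on {0..} W"
    unfolding continuous_on_eq_continuous_within
  proof
    fix x :: real assume x: "x \<in> {0..}"
    have "at x within {0..} = at x within {0..x + 1}"
      by (rule at_within_nhd[of _ "{..<x+1}"]) auto
    then show "continuous (at x within {0..}) W"
      using DERIV_continuous[OF W_within[of x "x + 1"]] x by simp
  qed
  define c where "c = u 1 - q' 1 - W 1"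
  have c: "u x - q' x - W x = c" if "0 < x" for x
  proof -
    have "\<exists>k. \<forall>x\<in>{0<..}. u x - q' x - W x = k"
    proof (rule has_field_derivative_zero_constant)
      show "((\<lambda>x. u x - q' x - W x) has_real_derivative 0) (at x within {0<..})"
        if "x \<in> {0<..}" for x
        using that
        by (auto intro!: derivative_eq_intros has_field_derivative_at_within[OF u']
            has_field_derivative_at_within[OF q''] has_field_derivative_at_within[OF W'])
    qed auto
    then show ?thesis using that by (auto simp: c_def)
  qed
  define w where "w x = W x + c" for x
  have w_cont: "continuous_on {0..} w"
    unfolding w_def by (intro continuous_intros W_cont)
  have q'_eq: "q' x = u x - w x" if "0 < x" for x
    using c[OF that] by (simp add: w_def)
  have "((\<lambda>x. u x - w x) \<longlongrightarrow> u 0 - w 0) (at 0 within {0..})"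
    using u w_cont by (intro tendsto_intros) (auto simp: continuous_on_def)
  then have lim: "((\<lambda>x. u x - w x) \<longlongrightarrow> u 0 - w 0) (at_right 0)"
    by (rule tendsto_within_subset) auto
  \<comment> \<open>The one-sided derivative of \<open>q\<close> at \<open>0\<close> is the limit of \<open>q'\<close>.\<close>
  have "((\<lambda>x. (q x - q 0) / x) \<longlongrightarrow> u 0 - w 0) (at_right 0)"
  proof (rule lhopital_right_0)
    have "(q \<longlongrightarrow> q 0) (at 0 within {0..})"
      using q_cont by (auto simp: continuous_on_def)
    then have "(q \<longlongrightarrow> q 0) (at_right 0)"
      by (rule tendsto_within_subset) auto
    then show "((\<lambda>x. q x - q 0) \<longlongrightarrow> 0) (at_right 0)"
      by (simp add: LIM_zero)
    have pos: "\<forall>\<^sub>F x in at_right 0. 0 < (x::real)"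
      by (simp add: eventually_at_right_less)
    show "\<forall>\<^sub>F x in at_right 0. ((\<lambda>x. q x - q 0) has_real_derivative q' x) (at x)"
      using pos by eventually_elim (auto intro!: derivative_eq_intros q')
    show "\<forall>\<^sub>F x in at_right 0. ((\<lambda>x. x) has_real_derivative 1) (at (x::real))"
      by (auto intro!: always_eventually)
    show "\<forall>\<^sub>F x in at_right 0. (x::real) \<noteq> 0"
      using pos by eventually_elim auto
    show "((\<lambda>x. q' x / 1) \<longlongrightarrow> u 0 - w 0) (at_right 0)"
      by (rule Lim_transform_eventually[OF lim]) (use pos q'_eq in \<open>auto elim: eventually_mono\<close>)
  qed (auto)
  moreover have "((\<lambda>x. (q x - q 0) / x) \<longlongrightarrow> 0) (at_right 0)"
    using q0 unfolding has_field_derivative_iff by (auto intro: tendsto_within_subset)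
  ultimately have "w 0 = u 0"
    using tendsto_unique trivial_limit_at_right_real by fastforce
  moreover have "(w has_real_derivative - q x) (at x)" if "0 < x" for x
    unfolding w_def by (auto intro!: derivative_eq_intros W' that)
  ultimately show ?thesis
    using that w_cont q'_eq by blast
qed

text \<open>The potential solves \<open>w - w'' = u\<close>. At an interior minimum of
  \<open>w y - w x\<close> over pairs one has \<open>w'' y \<ge> 0 \<ge> w'' x\<close>, so
  \<open>w y - w x \<ge> u y - u x\<close>; for \<open>x = 0\<close> the boundary condition replaces the
  inequality at \<open>x\<close>. The penalty \<open>\<epsilon> * y\<close> is linear, so it does not enter the
  second derivatives, and it dominates \<open>w\<close> at infinity because \<open>w' = - q\<close> tends
  to \<open>0\<close>.\<close>

lemma screened_potential_drop_bound:
  fixes u w q :: "real \<Rightarrow> real"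
  assumes w_cont: "continuous_on {0..} w"
    and w0: "w 0 = u 0"
    and w': "\<And>x. 0 < x \<Longrightarrow> (w has_real_derivative - q x) (at x)"
    and q': "\<And>x. 0 < x \<Longrightarrow> (q has_real_derivative u x - w x) (at x)"
    and q_lim: "(q \<longlongrightarrow> 0) at_top"
    and N: "0 \<le> N"
    and u: "\<And>x y. 0 \<le> x \<Longrightarrow> x \<le> y \<Longrightarrow> - N \<le> u y - u x"
    and ab: "0 \<le> a" "a \<le> b"
  shows "- N \<le> w b - w a"
proof (rule ccontr)
  assume "\<not> - N \<le> w b - w a"
  then have viol: "w b - w a < - N" by simp
  \<comment> \<open>Small enough for the violation at \<open>(a, b)\<close> to survive the penalty.\<close>
  define \<epsilon> where "\<epsilon> = (- N - (w b - w a)) / (2 * (b + 1))"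
  have \<epsilon>: "0 < \<epsilon>"
    using viol ab by (simp add: \<epsilon>_def)
  have \<epsilon>b: "\<epsilon> * b < - N - (w b - w a)"
  proof -
    have "\<epsilon> * (2 * (b + 1)) = - N - (w b - w a)"
      using ab by (simp add: \<epsilon>_def)
    moreover have "\<epsilon> * b < \<epsilon> * (2 * (b + 1))"
      using \<epsilon> ab by (intro mult_strict_left_mono) auto
    ultimately show ?thesis by simp
  qed
  define F where "F = (\<lambda>(x, y). w y - w x + \<epsilon> * y + N)"
  define S where "S = {(x::real, y). 0 \<le> x \<and> x \<le> y}"
  obtain Y where Y: "0 < Y" "\<And>x. Y \<le> x \<Longrightarrow> \<bar>q x\<bar> < \<epsilon> / 2"
  proof -
    have "\<forall>\<^sub>F x in at_top. dist (q x) 0 < \<epsilon> / 2"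
      using q_lim \<epsilon> by (intro tendstoD) auto
    then obtain Z where "\<And>x. Z \<le> x \<Longrightarrow> \<bar>q x\<bar> < \<epsilon> / 2"
      by (auto simp: eventually_at_top_linorder)
    then show ?thesis using that[of "max Z 1"] by auto
  qed
  have slow: "w x - w y \<le> \<epsilon> / 2 * (y - x)" if "Y \<le> x" "x \<le> y" for x y
  proof (cases "x = y")
    case False
    then have "x < y" using that by simp
    then have "\<exists>z>x. z < y \<and> w y - w x = (y - x) * - q z"
      by (rule MVT2) (use w' that Y(1) in auto)
    then obtain z where z: "x < z" "z < y" "w y - w x = (y - x) * - q z"
      by blast
    have "(y - x) * q z \<le> (y - x) * (\<epsilon> / 2)"
      using Y(2)[of z] z that by (intro mult_left_mono) auto
    then show ?thesis using z(3) by (simp add: algebra_simps)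
  qed auto
  obtain C where C: "\<And>x. 0 \<le> x \<Longrightarrow> x \<le> Y \<Longrightarrow> w x \<le> C"
    using continuous_attains_sup[of "{0..Y}" w] continuous_on_subset[OF w_cont, of "{0..Y}"] Y(1)
    by fastforce
  \<comment> \<open>Beyond \<open>R\<close> the penalty exceeds any fall of \<open>w\<close>, wherever \<open>x\<close> lies.\<close>
  define R where "R = max Y (2 * (C - w Y) / \<epsilon>)"
  have far: "0 \<le> F (x, y)" if "0 \<le> x" "x \<le> y" "R \<le> y" for x y
  proof (cases "Y \<le> x")
    case True
    have "\<epsilon> / 2 * (y - x) \<le> \<epsilon> * y"
      using \<epsilon> that by (simp add: field_simps add_increasing)
    then show ?thesis
      using slow[OF True that(2)] N by (simp add: F_def)
  next
    case False
    have "w Y - w y \<le> \<epsilon> / 2 * (y - Y)"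
      using slow[of Y y] that by (simp add: R_def)
    also have "\<dots> \<le> \<epsilon> / 2 * y"
      using \<epsilon> Y(1) by (intro mult_left_mono) auto
    finally have 1: "w Y - w y \<le> \<epsilon> / 2 * y" .
    have "2 * (C - w Y) / \<epsilon> \<le> y"
      using that by (simp add: R_def)
    then have "C - w Y \<le> \<epsilon> / 2 * y"
      using \<epsilon> by (simp add: field_simps)
    then show ?thesis
      using 1 C[of x] False that N by (simp add: F_def)
  qed
  have F_cont: "continuous_on S F"
  proof -
    have "continuous_on S (\<lambda>p. w (snd p) - w (fst p) + \<epsilon> * snd p + N)"
      by (intro continuous_intros continuous_on_compose2[OF w_cont]) (auto simp: S_def)
    then show ?thesis by (simp add: F_def split_beta)
  qed
  have K: "compact (S \<inter> ({0..R} \<times> {0..R}))"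
  proof (rule closed_Int_compact)
    have "S = {p. 0 \<le> fst p} \<inter> {p. fst p \<le> snd p}" by (auto simp: S_def)
    then show "closed S"
      by (auto intro!: closed_Int closed_Collect_le continuous_intros)
  qed (intro compact_Times compact_Icc)
  obtain p where p: "p \<in> S" "F p < 0" "\<And>p'. p' \<in> S \<Longrightarrow> F p \<le> F p'"
  proof (rule negative_minimum_attained[OF K _ F_cont])
    show "0 \<le> F p'" if "p' \<in> S - S \<inter> ({0..R} \<times> {0..R})" for p'
      using that far by (cases p') (auto simp: S_def)
    show "(a, b) \<in> S" "F (a, b) < 0"
      using ab \<epsilon>b by (auto simp: S_def F_def)
  qed auto
  obtain x y where xy: "p = (x, y)" by force
  have x: "0 \<le> x" and y: "x < y"
  proof -
    show "0 \<le> x" using p(1) xy by (auto simp: S_def)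
    then have "0 \<le> F (x, x)"
      using N \<epsilon> by (simp add: F_def)
    then have "x \<noteq> y"
      using p(2) xy by auto
    then show "x < y"
      using p(1) xy by (auto simp: S_def)
  qed
  have neg: "w y - w x < - N"
    using p(2) xy \<epsilon> x y by (simp add: F_def) (smt (verit) mult_nonneg_nonneg)
  have "0 \<le> - (u y - w y)"
  proof (rule second_derivative_nonneg_at_min[where v = "\<lambda>z. w z + \<epsilon> * z" and v' = "\<lambda>z. - q z + \<epsilon>"])
    show "0 < y - x" using y by simp
    show "((\<lambda>z. w z + \<epsilon> * z) has_real_derivative - q z + \<epsilon>) (at z)" if "\<bar>z - y\<bar> < y - x" for z
      using that x by (auto intro!: derivative_eq_intros w')
    show "((\<lambda>z. - q z + \<epsilon>) has_real_derivative - (u y - w y)) (at y)"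
      using x y by (auto intro!: derivative_eq_intros q')
    show "w y + \<epsilon> * y \<le> w z + \<epsilon> * z" if "\<bar>z - y\<bar> < y - x" for z
      using p(3)[of "(x, z)"] that x xy by (auto simp: S_def F_def)
  qed
  moreover have "0 \<le> u x - w x"
  proof (cases "x = 0")
    case False
    show ?thesis
    proof (rule second_derivative_nonneg_at_min[where v = "\<lambda>z. - w z" and v' = q])
      show "0 < min x (y - x)" using x y False by simp
      show "((\<lambda>z. - w z) has_real_derivative q z) (at z)" if "\<bar>z - x\<bar> < min x (y - x)" for z
        using that by (auto intro!: derivative_eq_intros w')
      show "(q has_real_derivative u x - w x) (at x)"
        using x False by (intro q') auto
      show "- w x \<le> - w z" if "\<bar>z - x\<bar> < min x (y - x)" for z
        using p(3)[of "(z, y)"] that x xy by (auto simp: S_def F_def abs_less_iff)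
    qed
  qed (simp add: w0)
  ultimately show False
    using neg u[of x y] x y by auto
qed

section \<open>The relaxation equation\<close>

text \<open>With \<open>Z = U y t - U x t\<close> the claim is that \<open>exp t * Z + N * (exp t - 1)\<close> stays
  non-negative. At a spatial minimum the transport terms vanish and the time derivative of this
  quantity is \<open>exp t * (w y t - w x t + N)\<close>, which is non-negative. The penalty
  \<open>\<epsilon> * y\<close> that makes the minimum exist leaves a transport error of at most
  \<open>\<epsilon> * L\<close> at \<open>y\<close>; the term \<open>\<epsilon> * (K * t)\<close> with \<open>K > L\<close>
  outweighs it and makes the time derivative strictly positive, which is impossible at a minimum
  reached at a positive time.\<close>

lemma relaxation_drop_bound:
  fixes U Ux Ut w c :: "real \<Rightarrow> real \<Rightarrow> real"
  assumes U_cont: "continuous_on ({0..} \<times> {0..}) (\<lambda>(x, t). U x t)"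
    and Ux: "\<And>x t. 0 < x \<Longrightarrow> 0 < t \<Longrightarrow> ((\<lambda>y. U y t) has_real_derivative Ux x t) (at x)"
    and Ut: "\<And>x t. 0 < x \<Longrightarrow> 0 < t \<Longrightarrow> ((\<lambda>s. U x s) has_real_derivative Ut x t) (at t)"
    and eq: "\<And>x t. 0 < x \<Longrightarrow> 0 < t \<Longrightarrow> Ut x t + c x t * Ux x t = w x t - U x t"
    and c: "\<And>x t. 0 < x \<Longrightarrow> 0 < t \<Longrightarrow> t \<le> T \<Longrightarrow> \<bar>c x t\<bar> \<le> L"
    and U0: "\<And>t. 0 < t \<Longrightarrow> U 0 t = m"
    and w0: "\<And>t. 0 < t \<Longrightarrow> w 0 t = m"
    and init: "\<And>x y. 0 \<le> x \<Longrightarrow> x \<le> y \<Longrightarrow> U x 0 \<le> U y 0"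
    and N: "0 \<le> N"
    and U_low: "\<And>x y t. 0 \<le> x \<Longrightarrow> x \<le> y \<Longrightarrow> 0 < t \<Longrightarrow> t \<le> T \<Longrightarrow> - N \<le> U y t - U x t"
    and w_low: "\<And>x y t. 0 \<le> x \<Longrightarrow> x \<le> y \<Longrightarrow> 0 < t \<Longrightarrow> t \<le> T \<Longrightarrow> - N \<le> w y t - w x t"
    and abs: "0 \<le> a" "a \<le> b" "0 < s" "s \<le> T"
  shows "- N * (1 - exp (- s)) \<le> U b s - U a s"
proof (rule ccontr)
  assume "\<not> - N * (1 - exp (- s)) \<le> U b s - U a s"
  then have "exp s * (U b s - U a s) < exp s * (- N * (1 - exp (- s)))"
    by (intro mult_strict_left_mono) auto
  then have viol: "exp s * (U b s - U a s) + N * (exp s - 1) < 0"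
    by (simp add: algebra_simps flip: exp_add)
  define K where "K = \<bar>L\<bar> + 1"
  define \<delta> where "\<delta> = - (exp s * (U b s - U a s) + N * (exp s - 1))"
  define \<epsilon> where "\<epsilon> = \<delta> / (2 * (b + K * s))"
  have bKs: "0 < b + K * s"
    using abs by (simp add: K_def add_nonneg_pos)
  have \<epsilon>: "0 < \<epsilon>" "\<epsilon> * (b + K * s) < \<delta>"
  proof -
    have "0 < \<delta>" using viol by (simp add: \<delta>_def)
    then show "0 < \<epsilon>" using bKs by (simp add: \<epsilon>_def)
    have "\<epsilon> * (b + K * s) = \<delta> / 2"
      unfolding \<epsilon>_def using bKs by (simp add: divide_simps)
    then show "\<epsilon> * (b + K * s) < \<delta>" using \<open>0 < \<delta>\<close> by simp
  qed
  define F where "F = (\<lambda>(x, y, t).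
     exp t * (U y t - U x t) + N * (exp t - 1) + \<epsilon> * (y + K * t))"
  define S where "S = {(x::real, y, t). 0 \<le> x \<and> x \<le> y \<and> 0 \<le> t \<and> t \<le> T}"
  define R where "R = N / \<epsilon>"
  have F_init: "0 \<le> F (x, y, 0)" if "0 \<le> x" "x \<le> y" for x y
    using init[OF that] that \<epsilon> by (simp add: F_def)
  have far: "0 \<le> F (x, y, t)" if "0 \<le> x" "x \<le> y" "0 \<le> t" "t \<le> T" "R \<le> y" for x y t
  proof (cases "t = 0")
    case True
    then show ?thesis using F_init that by simp
  next
    case False
    have "exp t * (- N) \<le> exp t * (U y t - U x t)"
      using U_low[of x y t] that False by (intro mult_left_mono) auto
    moreover have "N \<le> \<epsilon> * y"
      using that(5) \<epsilon>(1) by (simp add: R_def field_simps)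
    moreover have "0 \<le> \<epsilon> * (K * t)"
      using \<epsilon> that by (simp add: K_def)
    ultimately show ?thesis
      by (simp add: F_def algebra_simps)
  qed
  have F_cont: "continuous_on S F"
  proof -
    have 1: "continuous_on S (\<lambda>p. U (fst (snd p)) (snd (snd p)))"
    proof -
      have "continuous_on S (\<lambda>p. case (fst (snd p), snd (snd p)) of (x, t) \<Rightarrow> U x t)"
        by (rule continuous_on_compose2[OF U_cont]) (auto simp: S_def intro!: continuous_intros)
      then show ?thesis by (simp add: split_beta)
    qed
    have 2: "continuous_on S (\<lambda>p. U (fst p) (snd (snd p)))"
    proof -
      have "continuous_on S (\<lambda>p. case (fst p, snd (snd p)) of (x, t) \<Rightarrow> U x t)"
        by (rule continuous_on_compose2[OF U_cont]) (auto simp: S_def intro!: continuous_intros)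
      then show ?thesis by (simp add: split_beta)
    qed
    have "continuous_on S (\<lambda>p. exp (snd (snd p)) * (U (fst (snd p)) (snd (snd p)) - U (fst p) (snd (snd p)))
        + N * (exp (snd (snd p)) - 1) + \<epsilon> * (fst (snd p) + K * snd (snd p)))"
      by (intro continuous_intros 1 2)
    then show ?thesis by (simp add: F_def split_beta)
  qed
  have K: "compact (S \<inter> ({0..R} \<times> {0..R} \<times> {0..T}))"
  proof (rule closed_Int_compact)
    have "S = {p. 0 \<le> fst p} \<inter> {p. fst p \<le> fst (snd p)} \<inter> {p. 0 \<le> snd (snd p)} \<inter> {p. snd (snd p) \<le> T}"
      by (auto simp: S_def)
    then show "closed S"
      by (auto intro!: closed_Int closed_Collect_le continuous_intros)
  qed (intro compact_Times compact_Icc)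
  obtain p where p: "p \<in> S" "F p < 0" "\<And>p'. p' \<in> S \<Longrightarrow> F p \<le> F p'"
  proof (rule negative_minimum_attained[OF K _ F_cont])
    show "0 \<le> F p'" if "p' \<in> S - S \<inter> ({0..R} \<times> {0..R} \<times> {0..T})" for p'
      using that far by (cases p') (auto simp: S_def)
    show "(a, b, s) \<in> S" "F (a, b, s) < 0"
      using abs \<epsilon> by (auto simp: S_def F_def \<delta>_def)
  qed auto
  obtain x y t where xyt: "p = (x, y, t)" by (cases p)
  have x: "0 \<le> x" and t: "0 < t" "t \<le> T" and y: "x < y"
  proof -
    show "0 \<le> x" "t \<le> T" using p(1) xyt by (auto simp: S_def)
    have "t \<noteq> 0"
      using p(1,2) xyt F_init[of x y] by (auto simp: S_def)
    then show "0 < t"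
      using p(1) xyt by (auto simp: S_def)
    have "0 \<le> F (x, x, t)"
      using \<open>0 \<le> x\<close> \<open>0 < t\<close> N \<epsilon> by (auto simp: F_def K_def)
    then have "x \<noteq> y"
      using p(2) xyt by auto
    then show "x < y"
      using p(1) xyt by (auto simp: S_def)
  qed
  have Ux_y: "exp t * Ux y t + \<epsilon> = 0"
  proof (rule DERIV_local_min)
    show "((\<lambda>z. F (x, z, t)) has_real_derivative exp t * Ux y t + \<epsilon>) (at y)"
      using x y t by (auto simp: F_def intro!: derivative_eq_intros Ux)
    show "0 < y - x" using y by simp
    show "\<forall>z. \<bar>y - z\<bar> < y - x \<longrightarrow> F (x, y, t) \<le> F (x, z, t)"
      using p(3) xyt x t by (auto simp: S_def)
  qed
  \<comment> \<open>The pure relaxation balance at the smaller point: at a positive \<open>x\<close> because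
    \<open>dx U\<close> vanishes there, at \<open>x = 0\<close> because both sides are zero.\<close>
  obtain Utx where Utx: "((\<lambda>r. U x r) has_real_derivative Utx) (at t)" "Utx = w x t - U x t"
  proof (cases "x = 0")
    case True
    have "((\<lambda>r. U 0 r) has_real_derivative 0) (at t)"
      by (rule has_field_derivative_transform_within_open[where f = "\<lambda>_. m" and S = "{0<..}"])
        (use t U0 in auto)
    then show ?thesis using that[of 0] True U0 w0 t by simp
  next
    case False
    have "exp t * - Ux x t = 0"
    proof (rule DERIV_local_min)
      show "((\<lambda>z. F (z, y, t)) has_real_derivative exp t * - Ux x t) (at x)"
        using x t False by (auto simp: F_def intro!: derivative_eq_intros Ux)
      show "0 < min x (y - x)" using x y False by simp
      show "\<forall>z. \<bar>x - z\<bar> < min x (y - x) \<longrightarrow> F (x, y, t) \<le> F (z, y, t)"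
      proof (intro allI impI)
        show "F (x, y, t) \<le> F (z, y, t)" if "\<bar>x - z\<bar> < min x (y - x)" for z
          using p(3)[of "(z, y, t)"] that xyt t by (auto simp: S_def abs_less_iff)
      qed
    qed
    then show ?thesis
      using that[of "Ut x t"] Ut[of x t] eq[of x t] x t False by auto
  qed
  define D where "D = exp t * (U y t - U x t) + exp t * (Ut y t - Utx) + N * exp t + \<epsilon> * K"
  have F_t: "((\<lambda>r. F (x, y, r)) has_real_derivative D) (at t)"
    unfolding F_def D_def using x y t
    by (auto intro!: derivative_eq_intros Ut Utx(1) simp: algebra_simps)
  \<comment> \<open>Only earlier times are compared, since the minimum may be reached at \<open>t = T\<close>.\<close>
  have "D \<le> 0"
  proof (rule ccontr)
    assume "\<not> D \<le> 0"
    then obtain e where e: "0 < e" "\<And>h. 0 < h \<Longrightarrow> h < e \<Longrightarrow> F (x, y, t - h) < F (x, y, t)"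
      using DERIV_pos_inc_left[OF F_t] by auto
    define h where "h = min e t / 2"
    have "0 < h" "h < e" "h < t" using e(1) t by (auto simp: h_def)
    then show False
      using e(2)[of h] p(3)[of "(x, y, t - h)"] xyt x y t by (auto simp: S_def)
  qed
  moreover have "0 < D"
  proof -
    have "Ut y t = w y t - U y t - c y t * Ux y t"
      using eq[of y t] x y t by simp
    then have "D = exp t * (w y t - w x t + N) - c y t * (exp t * Ux y t) + \<epsilon> * K"
      unfolding D_def Utx(2) by (simp only:) (simp add: algebra_simps)
    also have "exp t * Ux y t = - \<epsilon>"
      using Ux_y by linarith
    also have "exp t * (w y t - w x t + N) - c y t * - \<epsilon> + \<epsilon> * K
        = exp t * (w y t - w x t + N) + \<epsilon> * (c y t + K)"
      by (simp add: algebra_simps)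
    also have "\<dots> > 0"
    proof (rule add_nonneg_pos)
      show "0 \<le> exp t * (w y t - w x t + N)"
        using w_low[of x y t] x y t by simp
      have "0 < c y t + K"
        using c[of y t] x y t by (auto simp: K_def)
      then show "0 < \<epsilon> * (c y t + K)"
        using \<epsilon> by simp
    qed
    finally show ?thesis .
  qed
  ultimately show False by simp
qed

section \<open>Monotonicity of the solution\<close>

theorem lemma2p4:
  fixes f :: "real \<Rightarrow> real" and \<alpha> um up :: real
    and U0 :: "real \<Rightarrow> real" and U Q :: "real \<Rightarrow> real \<Rightarrow> real"
  assumes "smooth f"
    and "\<alpha> > 0" and "\<And>u. deriv (deriv f) u \<ge> \<alpha>"
    and "f 0 = 0" and "deriv f 0 = 0"
    and "0 \<le> deriv f um" and "deriv f um < deriv f up"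
    and "\<And>x. x > 0 \<Longrightarrow> U0 differentiable (at x)"
    and "\<And>x. x > 0 \<Longrightarrow> deriv U0 x \<ge> 0"
    and "radiating_gas_solution f um up U0 U Q"
  shows "\<forall>x>0. \<forall>t>0. dx U x t \<ge> 0 \<and> Q x t \<le> 0"
proof -
  note sol = assms(10)[unfolded radiating_gas_solution_def C1_quadrant_def]
  have U_cont: "continuous_on ({0..} \<times> {0..}) (\<lambda>(x, t). U x t)"
    using sol by blast
  have Ux: "((\<lambda>y. U y t) has_real_derivative dx U x t) (at x)"
    and Ut: "((\<lambda>s. U x s) has_real_derivative dt U x t) (at t)" if "0 < x" "0 < t" for x t
    using sol that by (auto simp: dx_def dt_def field_differentiable_derivI DERIV_deriv_iff_real_differentiable)
  have Qx: "((\<lambda>y. Q y t) has_real_derivative dx Q x t) (at x)"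
    and Qxx: "((\<lambda>y. dx Q y t) has_real_derivative Q x t + dx U x t) (at x)" if "0 < x" "0 < t" for x t
  proof -
    show "((\<lambda>y. Q y t) has_real_derivative dx Q x t) (at x)"
      using sol that by (auto simp: dx_def DERIV_deriv_iff_real_differentiable)
    have "((\<lambda>y. dx Q y t) has_real_derivative dx (dx Q) x t) (at x)"
      using sol that unfolding dx_def[of "dx Q"] by (auto simp: DERIV_deriv_iff_real_differentiable)
    moreover have "- dx (dx Q) x t + Q x t + dx U x t = 0"
      using sol that by blast
    ultimately show "((\<lambda>y. dx Q y t) has_real_derivative Q x t + dx U x t) (at x)"
      by (simp add: algebra_simps)
  qed
  have U_zero: "U 0 t = um" if "0 < t" for t
    using sol that by blast
  have slice_cont: "continuous_on {0..} (\<lambda>x. U x t)" if "0 \<le> t" for t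
  proof -
    have "continuous_on {0..} (\<lambda>x. case (x, t) of (x, t) \<Rightarrow> U x t)"
      by (rule continuous_on_compose2[OF U_cont]) (use that in \<open>auto intro!: continuous_intros\<close>)
    then show ?thesis by simp
  qed
  have "\<exists>w. continuous_on {0..} w \<and> w 0 = um \<and>
      (\<forall>x>0. (w has_real_derivative - Q x t) (at x)) \<and> (\<forall>x>0. dx Q x t = U x t - w x)"
    if t: "0 < t" for t
  proof (rule screened_potential_exists[of "\<lambda>x. U x t" "\<lambda>x. dx U x t" "\<lambda>x. Q x t" "\<lambda>x. dx Q x t"])
    show "((\<lambda>x. Q x t) has_real_derivative 0) (at 0 within {0..})"
      using sol t by blast
  qed (use t slice_cont Ux Qx Qxx U_zero in auto)
  then obtain v where v: "\<And>t. 0 < t \<Longrightarrow> continuous_on {0..} (v t) \<and> v t 0 = um \<and>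
      (\<forall>x>0. (v t has_real_derivative - Q x t) (at x)) \<and> (\<forall>x>0. dx Q x t = U x t - v t x)"
    by metis
  define w where "w x t = v t x" for x t
  have w_cont: "continuous_on {0..} (\<lambda>x. w x t)" and w0: "w 0 t = um"
    and w': "0 < x \<Longrightarrow> ((\<lambda>x. w x t) has_real_derivative - Q x t) (at x)"
    and Qx_w: "0 < x \<Longrightarrow> dx Q x t = U x t - w x t" if "0 < t" for x t
    using v[OF that] by (auto simp: w_def)
  have Qx': "((\<lambda>x. Q x t) has_real_derivative U x t - w x t) (at x)" if "0 < x" "0 < t" for x t
    using Qx Qx_w that by metis
  have Q_lim: "((\<lambda>x. Q x t) \<longlongrightarrow> 0) at_top" if "0 < t" for t
    using sol that by blast
  have w_drop: "- N \<le> w y t - w x t"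
    if "0 < t" "0 \<le> N" "\<And>x y. 0 \<le> x \<Longrightarrow> x \<le> y \<Longrightarrow> - N \<le> U y t - U x t" "0 \<le> x" "x \<le> y" for N t x y
    by (rule screened_potential_drop_bound[where u = "\<lambda>x. U x t" and q = "\<lambda>x. Q x t"])
      (use that w_cont w0 U_zero w' Qx' Q_lim in auto)
  have f': "(f has_real_derivative deriv f u) (at u)" for u
    using assms(1) unfolding smooth_def DERIV_deriv_iff_real_differentiable
    by (metis funpow_0)
  have f'_cont: "continuous_on A (deriv f)" for A
  proof -
    have "deriv f differentiable (at u)" for u
      using assms(1)[unfolded smooth_def, rule_format, of 1 u] by simp
    then show ?thesis
      by (meson continuous_at_imp_continuous_on differentiable_imp_continuous_within)
  qed
  have pde: "\<forall>x>0. \<forall>t>0. dt U x t + dx (\<lambda>y s. f (U y s)) x t + dx Q x t = 0"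
    using sol by (elim conjE)
  have eq: "dt U x t + deriv f (U x t) * dx U x t = w x t - U x t" if "0 < x" "0 < t" for x t
  proof -
    have "((\<lambda>y. f (U y t)) has_real_derivative deriv f (U x t) * dx U x t) (at x)"
      by (rule DERIV_chain2[OF f' Ux[OF that]])
    then have "dx (\<lambda>y s. f (U y s)) x t = deriv f (U x t) * dx U x t"
      unfolding dx_def by (rule DERIV_imp_deriv)
    moreover have "dt U x t + dx (\<lambda>y s. f (U y s)) x t + dx Q x t = 0"
      using pde that by simp
    ultimately show ?thesis using Qx_w that by simp
  qed
  have init: "U x 0 \<le> U y 0" if "0 \<le> x" "x \<le> y" for x y
  proof -
    have pos: "U x 0 \<le> U y 0" if "0 < x" "x \<le> y" for x y
    proof -
      have "U0 x \<le> U0 y"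
        by (rule DERIV_nonneg_imp_nondecreasing[OF \<open>x \<le> y\<close>])
          (use assms(8,9) \<open>0 < x\<close> DERIV_deriv_iff_real_differentiable in \<open>meson less_le_trans\<close>)
      then show ?thesis using sol that by auto
    qed
    consider "x = y" | "0 < x" | "x = 0" "0 < y" using \<open>0 \<le> x\<close> \<open>x \<le> y\<close> by linarith
    then show ?thesis
    proof cases
      case 3
      have "((\<lambda>z. U z 0) \<longlongrightarrow> U 0 0) (at 0 within {0..})"
        using slice_cont[of 0] by (auto simp: continuous_on_def)
      then have "((\<lambda>z. U z 0) \<longlongrightarrow> U 0 0) (at_right 0)"
        by (rule tendsto_within_subset) auto
      moreover have "\<forall>\<^sub>F z in at_right 0. U z 0 \<le> U y 0"
        using eventually_at_right_real[OF 3(2)] by eventually_elim (auto intro: pos)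
      ultimately show ?thesis
        using 3(1) tendsto_upperbound trivial_limit_at_right_real by blast
    qed (use pos that in auto)
  qed
  have mono: "U x T \<le> U y T" if T: "0 < T" and xy: "0 \<le> x" "x \<le> y" for x y T
  proof -
    obtain B where B: "\<And>x t. 0 < x \<Longrightarrow> 0 < t \<Longrightarrow> t < T + 1 \<Longrightarrow> \<bar>U x t\<bar> \<le> B"
    proof -
      have "bounded ((\<lambda>(x, t). U x t) ` ({0<..} \<times> {0<..<T + 1}))"
        using sol T by auto
      then show ?thesis
        using that unfolding bounded_iff by fastforce
    qed
    have B': "\<bar>U x t\<bar> \<le> max B \<bar>um\<bar>" if "0 \<le> x" "0 < t" "t \<le> T" for x t
      using B[of x t] U_zero[of t] that by (cases "x = 0") auto
    obtain L where L: "\<And>u. \<bar>u\<bar> \<le> B \<Longrightarrow> \<bar>deriv f u\<bar> \<le> L"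
    proof -
      have "bounded (deriv f ` {- B..B})"
        by (intro compact_imp_bounded compact_continuous_image f'_cont compact_Icc)
      then obtain L where "\<forall>u\<in>{- B..B}. \<bar>deriv f u\<bar> \<le> L"
        by (auto simp: bounded_iff)
      then show ?thesis
        using that[of L] by (auto simp: abs_le_iff)
    qed
    \<comment> \<open>The supremum \<open>N\<close> of all falls up to time \<open>T\<close> is finite because \<open>U\<close> is bounded on
      the strip; bounding it by a fraction of itself shows that it vanishes.\<close>
    define I where "I = {(x::real, y, t). 0 \<le> x \<and> x \<le> y \<and> 0 < t \<and> t \<le> T}"
    define fall where "fall = (\<lambda>(x, y, t). U x t - U y t)"
    define N where "N = Sup (fall ` I)"
    have "fall p \<le> 2 * max B \<bar>um\<bar>" if "p \<in> I" for p
    proof -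
      obtain x y t where p: "p = (x, y, t)" by (cases p)
      then show ?thesis
        using B'[of x t] B'[of y t] that by (auto simp: I_def fall_def)
    qed
    then have bdd: "bdd_above (fall ` I)"
      by (rule bdd_aboveI2)
    have N_ub: "fall p \<le> N" if "p \<in> I" for p
      unfolding N_def using bdd that by (rule cSUP_upper2) auto
    have "(0, 0, T) \<in> I"
      using T by (simp add: I_def)
    then have ne: "I \<noteq> {}" by auto
    have N0: "0 \<le> N"
      using N_ub[OF \<open>(0, 0, T) \<in> I\<close>] by (simp add: fall_def)
    have U_drop: "- N \<le> U y t - U x t" if "0 \<le> x" "x \<le> y" "0 < t" "t \<le> T" for x y t
      using N_ub[of "(x, y, t)"] that by (simp add: I_def fall_def)
    have improved: "- N * (1 - exp (- t)) \<le> U y t - U x t"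
      if "0 \<le> x" "x \<le> y" "0 < t" "t \<le> T" for x y t
    proof (rule relaxation_drop_bound[OF U_cont Ux Ut eq, where m = um and T = T and L = L])
      show "\<bar>deriv f (U x t)\<bar> \<le> L" if "0 < x" "0 < t" "t \<le> T" for x t
        using L B that by simp
      show "- N \<le> w y t - w x t" if "0 \<le> x" "x \<le> y" "0 < t" "t \<le> T" for x y t
        using w_drop[of t N x y] U_drop N0 that by simp
    qed (use that U_zero w0 init U_drop N0 in auto)
    have "Sup (fall ` I) \<le> N * (1 - exp (- T))"
    proof (rule cSUP_least[OF ne])
      fix p assume "p \<in> I"
      then obtain x y t where p: "p = (x, y, t)" "0 \<le> x" "x \<le> y" "0 < t" "t \<le> T"
        by (auto simp: I_def)
      have "fall p \<le> N * (1 - exp (- t))"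
        using improved[OF p(2-)] by (simp add: p(1) fall_def)
      also have "\<dots> \<le> N * (1 - exp (- T))"
        using N0 p by (intro mult_left_mono) auto
      finally show "fall p \<le> N * (1 - exp (- T))" .
    qed
    then have "N * exp (- T) \<le> 0"
      by (simp add: algebra_simps flip: N_def)
    then have "N \<le> 0"
      by (simp add: mult_le_0_iff)
    then show ?thesis
      using U_drop[OF xy T] by simp
  qed
  have w_mono: "w x t \<le> w y t" if "0 < t" "0 \<le> x" "x \<le> y" for x y t
    using w_drop[of t 0 x y] mono that by simp
  show ?thesis
  proof (intro allI impI conjI)
    fix x t :: real assume x: "0 < x" and t: "0 < t"
    show "0 \<le> dx U x t"
      by (rule derivative_nonneg_of_right_min[OF Ux[OF x t]]) (use mono x t in auto)
    have "0 \<le> - Q x t"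
      by (rule derivative_nonneg_of_right_min[OF w'[OF t x]]) (use w_mono x t in auto)
    then show "Q x t \<le> 0" by simp
  qed
qed

end
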